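(* For all integers $k,d\ge1$ there exists a planar graph $G_{k,d}$ with a $(k,d)$-comatching of size at least \[\left(2\left\lfloor\frac{d}{k}\right\rfloor+2\right)^k\ \text{ if } k\le d;\qquad \left(3\left\lfloor\frac{k}{d}\right\rfloor+1\right)^d\ \text{ if } d\le k.\]
   Context: Graphs are finite and unweighted; $\mathrm{dist}$ is the shortest-path (hop) distance, and $\mathrm{dist}(v,X)=\min_{x\in X}\mathrm{dist}(v,x)$ for a nonempty vertex set $X$. For integers $k,d\ge1$, a $(k,d)$-comatching in a graph $G$ is a family $\mathcal{M}$ of ordered pairs $(p,X)$, where $p\in V(G)$ and $X\subseteq V(G)$ is a set of $k$ vertices, such that $\mathrm{dist}(p,X)>d$ for every $(p,X)\in\mathcal{M}$, and $\mathrm{dist}(p,X')\le d$ for all distinct $(p,X),(p',X')\in\mathcal{M}$. *)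

theory Defs
  imports
    "HOL-Analysis.Analysis"
    "Graph_Theory.Pair_Digraph"
    "Graph_Theory.Shortest_Path"
begin

text \<open>
  An undirected edge between \<open>u\<close> and \<open>v\<close> of a \<^const>\<open>pair_graph\<close> is given by the two arcs
  \<open>(u, v)\<close> and \<open>(v, u)\<close>. Distances are extended reals: vertices in different components have
  distance \<open>\<infinity>\<close>.
\<close>

definition hop_dist :: "'a pair_pre_digraph \<Rightarrow> 'a \<Rightarrow> 'a \<Rightarrow> ereal" where
  "hop_dist G u v = wf_digraph.\<mu> (with_proj G) (\<lambda>_. 1) u v"

definition hop_dist_set :: "'a pair_pre_digraph \<Rightarrow> 'a \<Rightarrow> 'a set \<Rightarrow> ereal" where
  "hop_dist_set G v X = Min (hop_dist G v ` X)"

text \<open>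
  A drawing in the plane without crossings. Curves are indexed by the unordered pairs
  \<open>{u, v}\<close>, so that the two arcs of an edge are drawn as one curve, whose orientation is
  irrelevant.
\<close>

definition plane_drawing ::
  "'a pair_pre_digraph \<Rightarrow> ('a \<Rightarrow> complex) \<Rightarrow> ('a set \<Rightarrow> real \<Rightarrow> complex) \<Rightarrow> bool" where
  "plane_drawing G pos crv \<longleftrightarrow>
     inj_on pos (pverts G) \<and>
     (\<forall>(u, v) \<in> parcs G.
        arc (crv {u, v}) \<and>
        {pathstart (crv {u, v}), pathfinish (crv {u, v})} = {pos u, pos v} \<and>
        path_image (crv {u, v}) \<inter> pos ` pverts G = {pos u, pos v}) \<and>
     (\<forall>(u, v) \<in> parcs G. \<forall>(x, y) \<in> parcs G. {u, v} \<noteq> {x, y} \<longrightarrow>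
        path_image (crv {u, v}) \<inter> path_image (crv {x, y}) \<subseteq> pos ` ({u, v} \<inter> {x, y}))"

definition planar_graph :: "'a pair_pre_digraph \<Rightarrow> bool" where
  "planar_graph G \<longleftrightarrow> pair_graph G \<and> (\<exists>pos crv. plane_drawing G pos crv)"

definition comatching ::
  "'a pair_pre_digraph \<Rightarrow> nat \<Rightarrow> nat \<Rightarrow> ('a \<times> 'a set) set \<Rightarrow> bool" where
  "comatching G k d M \<longleftrightarrow>
     (\<forall>(p, X) \<in> M. p \<in> pverts G \<and> X \<subseteq> pverts G \<and> card X = k) \<and>
     (\<forall>(p, X) \<in> M. hop_dist_set G p X > ereal (real d)) \<and>
     (\<forall>(p, X) \<in> M. \<forall>(p', X') \<in> M. (p, X) \<noteq> (p', X') \<longrightarrow>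
        hop_dist_set G p X' \<le> ereal (real d))"

end

theory Submission
  imports Defs "HOL-Library.List_Lexorder"
begin

text \<open>
  Let \<open>n = min k d\<close>, \<open>s = \<lfloor>d / n\<rfloor>\<close>, \<open>t = \<lfloor>k / n\<rfloor>\<close> and \<open>m = (2 s + 1) t + 1\<close>; in both cases of the
  statement the bound is \<open>m ^ n\<close>. On a cycle of length \<open>m\<close>, the vertices at distance at least
  \<open>s + 1\<close> from a vertex \<open>a\<close> contain \<open>t\<close> vertices whose \<open>s\<close>-balls cover exactly the cycle minus \<open>a\<close>.
  Build an \<open>m\<close>-ary tree of depth \<open>n\<close> of such wheels: the children of every inner node form a cycle,
  the rim, and are joined to their parent by spokes of length \<open>s\<close>, so that there is no shortcut
  between rim vertices at distance at most \<open>s + 1\<close>. Every node also carries a pendant path. The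
  \<open>m ^ n\<close> leaves are the points. For the set of a leaf \<open>a\<close>, take, at each of the \<open>n\<close> levels, the
  \<open>t\<close> vertices of the rim through the ancestor of \<open>a\<close> that cover all of this rim but the ancestor,
  and move outwards along their pendant paths by \<open>d - s (n - i)\<close>, where \<open>i < n\<close> is the level,
  counted from \<open>0\<close>. Another leaf \<open>b\<close> gets within distance \<open>d\<close> of this set at the level at which
  it branches off from \<open>a\<close>.

  The graph is planar because it has a two-page book embedding: the vertices are ordered by a
  depth-first search of the tree, the tree edges form the upper page and the rims the lower one.
\<close>

section \<open>Two-page book embeddings are planar\<close>

text \<open>The factor \<open>(b - a)\<^sup>2\<close> turns the arc into the graph of
  \<open>\<sigma> * (x - a) * (b - x)\<close> over \<open>[a, b]\<close>. All arcs on one page thus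
  share a leading coefficient and are nested when their intervals are.\<close>

definition parabola :: "real \<Rightarrow> real \<Rightarrow> real \<Rightarrow> real \<Rightarrow> complex" where
  "parabola \<sigma> a b t = Complex (a + (b - a) * t) (\<sigma> * (b - a)\<^sup>2 * t * (1 - t))"

lemma arc_parabola:
  assumes "a \<noteq> b"
  shows "arc (parabola \<sigma> a b)"
  unfolding arc_def path_def
proof
  have "parabola \<sigma> a b = (\<lambda>t. of_real (a + (b - a) * t) + \<i> * of_real (\<sigma> * (b - a)\<^sup>2 * t * (1 - t)))"
    by (auto simp: parabola_def complex_eq_iff)
  then show "continuous_on {0..1} (parabola \<sigma> a b)"
    by (auto intro!: continuous_intros)
  show "inj_on (parabola \<sigma> a b) {0..1}"
    using assms by (auto simp: inj_on_def parabola_def)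
qed

lemma pathstart_parabola: "pathstart (parabola \<sigma> a b) = of_real a"
  and pathfinish_parabola: "pathfinish (parabola \<sigma> a b) = of_real b"
  by (auto simp: pathstart_def pathfinish_def parabola_def complex_eq_iff)

lemma in_path_image_parabola:
  assumes "z \<in> path_image (parabola \<sigma> a b)" "a < b"
  shows "a \<le> Re z" "Re z \<le> b" "Im z = \<sigma> * ((Re z - a) * (b - Re z))"
proof -
  obtain t where t: "0 \<le> t" "t \<le> 1" "z = parabola \<sigma> a b t"
    using assms by (auto simp: path_image_def)
  have "(b - a) * t \<le> (b - a) * 1" "(b - a) * t \<ge> 0"
    using t assms by (auto intro!: mult_left_mono)
  then show "a \<le> Re z" "Re z \<le> b"
    using t by (auto simp: parabola_def)
  show "Im z = \<sigma> * ((Re z - a) * (b - Re z))"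
    using t by (simp add: parabola_def power2_eq_square algebra_simps)
qed

text \<open>Over a point strictly inside both intervals, arcs on different pages lie on opposite
  sides of the axis; arcs on one page have nested intervals, and the wider one is strictly farther
  from the axis.\<close>

lemma parabolas_meet_at_endpoints:
  assumes z: "z \<in> path_image (parabola \<sigma> a b)" "z \<in> path_image (parabola \<tau> c d)"
    and lt: "a < b" "c < d" and ne: "(a, b) \<noteq> (c, d)"
    and sign: "\<sigma> \<in> {1, -1}" "\<tau> \<in> {1, -1}"
    and page: "a < c \<and> c < b \<and> b < d \<or> c < a \<and> a < d \<and> d < b \<Longrightarrow> \<sigma> \<noteq> \<tau>"
  shows "\<exists>x \<in> {a, b} \<inter> {c, d}. z = of_real x"
proof -
  define x where "x = Re z"
  note ab = in_path_image_parabola[OF z(1) lt(1), folded x_def]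
    and cd = in_path_image_parabola[OF z(2) lt(2), folded x_def]
  have nn: "(x - a) * (b - x) \<ge> 0" "(x - c) * (d - x) \<ge> 0"
    using ab cd by auto
  have zero: "(x - a) * (b - x) = 0 \<and> (x - c) * (d - x) = 0"
  proof (rule ccontr)
    assume nz: "\<not> ?thesis"
    have *: "\<sigma> * ((x - a) * (b - x)) = \<tau> * ((x - c) * (d - x))"
      using ab(3) cd(3) by simp
    have eq: "\<sigma> = \<tau>"
    proof (rule ccontr)
      assume "\<sigma> \<noteq> \<tau>"
      then have "(x - a) * (b - x) = - ((x - c) * (d - x))"
        using * sign by (elim insertE emptyE; simp; linarith)
      then show False
        using nn nz by linarith
    qed
    with * sign have eq': "(x - a) * (b - x) = (x - c) * (d - x)"
      by auto
    then have "x \<noteq> a" "x \<noteq> b" "x \<noteq> c" "x \<noteq> d"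
      using nz by auto
    then have x: "a < x" "x < b" "c < x" "x < d"
      using ab cd by auto
    consider "a \<le> c" "d \<le> b" "a < c \<or> d < b" | "c \<le> a" "b \<le> d" "c < a \<or> b < d"
      using page eq ne x by fastforce
    then show False
    proof cases
      case 1
      then have "(x - c) * (d - x) < (x - a) * (b - x)"
        using x by (auto intro: mult_strict_mono' mult_le_less_imp_less mult_less_le_imp_less)
      then show False using eq' by simp
    next
      case 2
      then have "(x - a) * (b - x) < (x - c) * (d - x)"
        using x by (auto intro: mult_strict_mono' mult_le_less_imp_less mult_less_le_imp_less)
      then show False using eq' by simp
    qed
  qed
  then have "Im z = 0" "x \<in> {a, b} \<inter> {c, d}"
    using ab(3) by auto
  then show ?thesis
    by (auto simp: x_def complex_eq_iff)
qed

text \<open>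
  The vertices are put on the real axis. Every edge is drawn as a parabola above or below the axis,
  according to its page.
\<close>
lemma planar_if_two_page:
  fixes G :: "nat pair_pre_digraph" and upper :: "nat \<Rightarrow> nat \<Rightarrow> bool"
  assumes G: "pair_graph G"
    and page: "\<And>u v x y. (u, v) \<in> parcs G \<Longrightarrow> (x, y) \<in> parcs G \<Longrightarrow> u < x \<Longrightarrow> x < v \<Longrightarrow> v < y \<Longrightarrow>
      upper u v \<noteq> upper x y"
  shows "planar_graph G"
proof -
  interpret pair_graph G by fact
  define pos :: "nat \<Rightarrow> complex" where "pos v = of_real (real v)" for v
  define \<sigma> :: "nat \<Rightarrow> nat \<Rightarrow> real" where "\<sigma> u v = (if upper u v then 1 else -1)" for u v
  \<comment> \<open>Both arcs of an edge share this curve, oriented from left to right by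
    \<open>Min\<close> and \<open>Max\<close>.\<close>
  define crv where "crv e = parabola (\<sigma> (Min e) (Max e)) (Min e) (Max e)" for e :: "nat set"
  have edge_cases: "\<exists>a b. a < b \<and> (a, b) \<in> parcs G \<and> {u, v} = {a, b} \<and>
      crv {u, v} = parabola (\<sigma> a b) a b" if "(u, v) \<in> parcs G" for u v
  proof -
    have "u \<noteq> v" "(v, u) \<in> parcs G"
      using no_loops' that arcs_symmetric by auto
    with that show ?thesis
      by (intro exI[of _ "min u v"] exI[of _ "max u v"]) (auto simp: crv_def min_def max_def)
  qed
  have "plane_drawing G pos crv"
    unfolding plane_drawing_def
  proof (intro conjI ballI, goal_cases)
    case 1
    show ?case by (auto simp: inj_on_def pos_def)
  next
    case (2 e)
    obtain u v where e: "e = (u, v)" by force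
    obtain a b where ab: "a < b" "(a, b) \<in> parcs G" "{u, v} = {a, b}"
      "crv {u, v} = parabola (\<sigma> a b) a b"
      using edge_cases 2 unfolding e by blast
    have ends: "{pathstart (crv {u, v}), pathfinish (crv {u, v})} = {pos u, pos v}"
      using ab(3) unfolding ab(4) pathstart_parabola pathfinish_parabola pos_def
      by (auto simp: doubleton_eq_iff)
    have "path_image (crv {u, v}) \<inter> pos ` pverts G \<subseteq> {pos u, pos v}"
    proof
      fix z assume z: "z \<in> path_image (crv {u, v}) \<inter> pos ` pverts G"
      then obtain w where w: "z = of_real (real w)" by (auto simp: pos_def)
      \<comment> \<open>A vertex is real, and the imaginary part of the parabola vanishes only at
        its two ends.\<close>
      then have "\<sigma> a b * ((real w - a) * (b - real w)) = 0"
        using in_path_image_parabola(3)[of z "\<sigma> a b" a b] z ab by auto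
      then have "w \<in> {u, v}"
        unfolding ab(3) by (auto simp: \<sigma>_def split: if_splits)
      then show "z \<in> {pos u, pos v}"
        by (auto simp: w pos_def)
    qed
    moreover have "{pos u, pos v} \<subseteq> path_image (crv {u, v}) \<inter> pos ` pverts G"
      unfolding ends[symmetric] using 2 wellformed'[of u v] ends
      by (fastforce simp: e intro: pathstart_in_path_image pathfinish_in_path_image)
    ultimately show ?case
      using ab(1) ends unfolding e by (auto simp: ab(4) arc_parabola)
  next
    case 3
    have "path_image (crv {u, v}) \<inter> path_image (crv {x, y}) \<subseteq> pos ` ({u, v} \<inter> {x, y})"
      if uvxy: "(u, v) \<in> parcs G" "(x, y) \<in> parcs G" "{u, v} \<noteq> {x, y}" for u v x y
    proof -
    obtain a b where ab: "a < b" "(a, b) \<in> parcs G" "{u, v} = {a, b}"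
      "crv {u, v} = parabola (\<sigma> a b) a b"
      using edge_cases uvxy by blast
    obtain c d where cd: "c < d" "(c, d) \<in> parcs G" "{x, y} = {c, d}"
      "crv {x, y} = parabola (\<sigma> c d) c d"
      using edge_cases uvxy by blast
    have "z \<in> pos ` ({a, b} \<inter> {c, d})"
      if "z \<in> path_image (crv {u, v})" "z \<in> path_image (crv {x, y})" "{a, b} \<noteq> {c, d}" for z
    proof -
      have "\<sigma> a b \<noteq> \<sigma> c d" if "a < c \<and> c < b \<and> b < d \<or> c < a \<and> a < d \<and> d < b"
        using that page[OF ab(2) cd(2)] page[OF cd(2) ab(2)] by (auto simp: \<sigma>_def)
      then have "\<exists>x \<in> {real a, real b} \<inter> {real c, real d}. z = of_real x"
        using that ab cd by (intro parabolas_meet_at_endpoints) (auto simp: \<sigma>_def)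
      then show ?thesis
        by (auto simp: pos_def image_iff)
    qed
    then show ?thesis
      using uvxy(3) unfolding ab(3) cd(3) by blast
    qed
    then show ?case
      using 3 by (intro case_prodI2 ballI impI) simp
  qed
  then show ?thesis
    using G by (auto simp: planar_graph_def)
qed

text \<open>Counting predecessors realises the order by natural numbers, which become positions on
  the real axis.\<close>

lemma ranking:
  fixes lt :: "'a \<Rightarrow> 'a \<Rightarrow> bool"
  assumes "finite V" "irreflp lt" "transp lt" "totalp_on V lt"
  obtains r :: "'a \<Rightarrow> nat" where "inj_on r V" "\<And>u v. u \<in> V \<Longrightarrow> v \<in> V \<Longrightarrow> r u < r v \<longleftrightarrow> lt u v"
proof
  define r where "r v = card {u \<in> V. lt u v}" for v
  have mono: "r u < r v" if "u \<in> V" "lt u v" for u v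
    unfolding r_def using that assms
    by (intro psubset_card_mono) (auto dest: transpD irreflpD)
  have trichotomy: "lt u v \<or> u = v \<or> lt v u" if "u \<in> V" "v \<in> V" for u v
    using assms(4) that by (auto dest: totalp_onD)
  show "inj_on r V"
  proof (rule inj_onI)
    fix u v assume "u \<in> V" "v \<in> V" "r u = r v"
    then show "u = v" using trichotomy[of u v] mono[of u v] mono[of v u] by auto
  qed
  show "r u < r v \<longleftrightarrow> lt u v" if "u \<in> V" "v \<in> V" for u v
    using trichotomy[OF that] mono[of u v] mono[of v u] that by auto
qed

section \<open>Copies of a relation as graphs\<close>

definition image_graph :: "('a \<Rightarrow> 'b) \<Rightarrow> 'a set \<Rightarrow> 'a rel \<Rightarrow> 'b pair_pre_digraph" where
  "image_graph r V E = \<lparr>pverts = r ` V, parcs = map_prod r r ` E\<rparr>"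

lemma pair_graph_image_graph:
  assumes "finite V" "E \<subseteq> V \<times> V" "sym E" "irrefl E" "inj_on r V"
  shows "pair_graph (image_graph r V E)"
proof
  have "finite E" using assms by (auto intro: finite_subset)
  then show "finite (parcs (image_graph r V E))" "finite (pverts (image_graph r V E))"
    using assms by (auto simp: image_graph_def)
  show "symmetric (with_proj (image_graph r V E))"
    using \<open>sym E\<close> by (force simp: symmetric_def image_graph_def sym_def)
  fix e assume "e \<in> parcs (image_graph r V E)"
  then obtain x y where "(x, y) \<in> E" "e = (r x, r y)"
    by (auto simp: image_graph_def)
  moreover from this have "x \<in> V" "y \<in> V" "x \<noteq> y"
    using assms by (auto simp: irrefl_def)
  ultimately show "fst e \<in> pverts (image_graph r V E)" "snd e \<in> pverts (image_graph r V E)"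
    "fst e \<noteq> snd e"
    using \<open>inj_on r V\<close> by (auto simp: image_graph_def inj_on_def)
qed

lemma two_page_image_graph:
  fixes lt upper :: "'a \<Rightarrow> 'a \<Rightarrow> bool"
  assumes V: "finite V" "E \<subseteq> V \<times> V" "sym E" "irrefl E"
    and lt: "irreflp lt" "transp lt" "totalp_on V lt"
    and page: "\<And>u v x y. (u, v) \<in> E \<Longrightarrow> (x, y) \<in> E \<Longrightarrow> lt u x \<Longrightarrow> lt x v \<Longrightarrow> lt v y \<Longrightarrow>
      upper u v \<noteq> upper x y"
  obtains r :: "'a \<Rightarrow> nat" where "inj_on r V" "planar_graph (image_graph r V E)"
proof -
  obtain r :: "'a \<Rightarrow> nat" where r: "inj_on r V"
    "\<And>u v. u \<in> V \<Longrightarrow> v \<in> V \<Longrightarrow> r u < r v \<longleftrightarrow> lt u v"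
    using ranking[OF V(1) lt] by blast
  have "planar_graph (image_graph r V E)"
  proof (rule planar_if_two_page[where upper = "\<lambda>u v. upper (inv_into V r u) (inv_into V r v)"])
    show "pair_graph (image_graph r V E)"
      using V r by (intro pair_graph_image_graph)
    fix u v x y
    assume "(u, v) \<in> parcs (image_graph r V E)" "(x, y) \<in> parcs (image_graph r V E)"
      and *: "u < x" "x < v" "v < y"
    then obtain u' v' x' y' where E: "(u', v') \<in> E" "(x', y') \<in> E"
      and eq: "u = r u'" "v = r v'" "x = r x'" "y = r y'"
      by (auto simp: image_graph_def)
    then have "u' \<in> V" "v' \<in> V" "x' \<in> V" "y' \<in> V"
      using V by auto
    then show "upper (inv_into V r u) (inv_into V r v) \<noteq> upper (inv_into V r x) (inv_into V r y)"
      using page[OF E] * r by (simp add: eq)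
  qed
  with r(1) that show ?thesis by blast
qed

section \<open>Upper and lower bounds on hop distances\<close>

lemma hop_dist_le:
  assumes "pair_wf_digraph G" "(u, v) \<in> parcs G ^^ l" "u \<in> pverts G"
  shows "hop_dist G u v \<le> ereal (real l)"
proof -
  interpret pair_wf_digraph G by fact
  have "\<exists>p. awalk u p v \<and> awalk_cost (\<lambda>_. 1) p = real l"
    using assms(2,3)
  proof (induction l arbitrary: u)
    case 0
    then show ?case by (intro exI[of _ "[]"]) (auto simp: awalk_Nil_iff)
  next
    case (Suc l)
    then obtain w where w: "(u, w) \<in> parcs G" "(w, v) \<in> parcs G ^^ l"
      by (meson relpow_Suc_D2)
    then obtain p where "awalk w p v" "awalk_cost (\<lambda>_. 1) p = real l"
      using Suc.IH wellformed' by blast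
    then show ?case
      using w Suc.prems by (intro exI[of _ "(u, w) # p"]) (auto simp: awalk_Cons_iff)
  qed
  then show ?thesis
    using min_cost_le_walk_cost unfolding hop_dist_def by metis
qed

text \<open>The decrements of \<open>f\<close> telescope along each walk. Without any walk the
  infimum is \<open>\<infinity>\<close>, so the bound persists.\<close>

lemma hop_dist_ge:
  fixes f :: "'a \<Rightarrow> int"
  assumes "pair_wf_digraph G" and lip: "\<And>x y. (x, y) \<in> parcs G \<Longrightarrow> f x - f y \<le> 1"
  shows "hop_dist G u v \<ge> ereal (real_of_int (f u - f v))"
proof -
  interpret pair_wf_digraph G by fact
  have "real_of_int (f u - f v) \<le> awalk_cost (\<lambda>_. 1) p" if "awalk u p v" for p
    using that
  proof (induction p arbitrary: u)
    case Nil
    then show ?case by (simp add: awalk_Nil_iff)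
  next
    case (Cons e p)
    then have *: "e \<in> parcs G" "fst e = u" "awalk (snd e) p v"
      by (auto simp: awalk_Cons_iff)
    then have "f u - f (snd e) \<le> 1"
      using lip[of u "snd e"] by (metis prod.collapse)
    then have "real_of_int (f u - f (snd e)) \<le> 1"
      by linarith
    then show ?case
      using Cons.IH[OF *(3)] by simp
  qed
  then show ?thesis
    unfolding hop_dist_def \<mu>_def by (auto intro: INF_greatest)
qed

lemma hop_dist_image_graph_le:
  assumes "pair_graph (image_graph r V E)" "(u, v) \<in> E ^^ l" "u \<in> V"
  shows "hop_dist (image_graph r V E) (r u) (r v) \<le> ereal (real l)"
proof (rule hop_dist_le)
  interpret pair_graph "image_graph r V E" by fact
  show "pair_wf_digraph (image_graph r V E)" ..
  show "r u \<in> pverts (image_graph r V E)"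
    using assms by (simp add: image_graph_def)
  show "(r u, r v) \<in> parcs (image_graph r V E) ^^ l"
    using assms(2)
  proof (induction l arbitrary: v)
    case (Suc l)
    then obtain w where "(u, w) \<in> E ^^ l" "(w, v) \<in> E" by auto
    with Suc.IH[of w] show ?case
      by (force simp: image_graph_def)
  qed simp
qed

lemma hop_dist_image_graph_ge:
  fixes f :: "'a \<Rightarrow> int"
  assumes "pair_graph (image_graph r V E)" "inj_on r V" "E \<subseteq> V \<times> V" "u \<in> V" "v \<in> V"
    and lip: "\<And>x y. (x, y) \<in> E \<Longrightarrow> f x - f y \<le> 1"
  shows "hop_dist (image_graph r V E) (r u) (r v) \<ge> ereal (real_of_int (f u - f v))"
proof -
  interpret pair_graph "image_graph r V E" by fact
  have "ereal (real_of_int (f (inv_into V r (r u)) - f (inv_into V r (r v))))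
      \<le> hop_dist (image_graph r V E) (r u) (r v)"
    using assms(2,3) lip
    by (intro hop_dist_ge pair_wf_digraph) (auto simp: image_graph_def)
  then show ?thesis
    using assms by simp
qed


section \<open>Trees of wheels\<close>

lemma append_less_append_iff [simp]: "xs @ ys < xs @ zs \<longleftrightarrow> ys < (zs :: 'a :: linorder list)"
  by (induction xs) auto

text \<open>A word strictly between \<open>w\<close> and \<open>w @ [a]\<close> lies in the subtree
  of an earlier child of \<open>w\<close>, which ends before \<open>w @ [a]\<close>. This excludes
  crossing spokes.\<close>

lemma child_less_child:
  fixes w w' :: "'a :: linorder list"
  assumes "w < w'" "w' < w @ [a]"
  shows "w' @ [b] < w @ [a]"
  using assms
proof (induction w arbitrary: w')
  case Nil
  then show ?case by (cases w') auto
next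
  case (Cons c w)
  then show ?case by (cases w') auto
qed

text \<open>\<open>w' @ [a']\<close> starts with \<open>w @ [c]\<close> for some
  \<open>c < b\<close>. Because \<open>w \<noteq> w'\<close>, so does \<open>w'\<close>, and hence
  each of its children. This excludes crossings of different rims.\<close>

lemma child_less_sibling:
  fixes w w' :: "'a :: linorder list"
  assumes "w @ [a] < w' @ [a']" "w' @ [a'] < w @ [b]" "w \<noteq> w'"
  shows "w' @ [b'] < w @ [b]"
  using assms
proof (induction w arbitrary: w')
  case Nil
  then show ?case by (cases w') auto
next
  case (Cons c w)
  then show ?case by (cases w') auto
qed

lemma sym_relpow:
  assumes "sym R" "(x, y) \<in> R ^^ l"
  shows "(y, x) \<in> R ^^ l"
  using assms(2)
proof (induction l arbitrary: y)
  case (Suc l)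
  then obtain z where "(z, x) \<in> R ^^ l" "(y, z) \<in> R"
    using \<open>sym R\<close> by (auto dest: symD)
  then show ?case by (rule relpow_Suc_I2[rotated])
qed simp

lemma relpow_trans: "(x, y) \<in> R ^^ k \<Longrightarrow> (y, z) \<in> R ^^ l \<Longrightarrow> (x, z) \<in> R ^^ (k + l)"
  by (auto simp: relpow_add)

section \<open>The tree of wheels and its book embedding\<close>

locale wheel_tree =
  fixes s t n h :: nat
  assumes s: "1 \<le> s" and t: "1 \<le> t"
begin

definition m :: int where "m = (2 * int s + 1) * int t + 1"

definition words :: "int list set" where
  "words = {w. set w \<subseteq> {0..<m} \<and> length w \<le> n}"

text \<open>The second coordinate starts at \<open>1 - int s\<close> because the edge from the
  parent is itself the first of the \<open>s\<close> edges of a spoke. Above the root this path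
  dangles.\<close>

definition verts :: "(int list \<times> int) set" where
  "verts = words \<times> {1 - int s..int h}"

text \<open>
  The node of the tree reached by the word \<open>w\<close> is \<open>(w, 0)\<close>. The inner vertices of the spoke above it
  are the \<open>(w, j)\<close> with \<open>j < 0\<close>, and its pendant path consists of the \<open>(w, j)\<close> with \<open>j > 0\<close>.
\<close>
inductive link :: "int list \<times> int \<Rightarrow> int list \<times> int \<Rightarrow> bool" where
  chain: "w \<in> words \<Longrightarrow> 1 - int s \<le> j \<Longrightarrow> j < int h \<Longrightarrow> link (w, j) (w, j + 1)"
| spoke: "w @ [a] \<in> words \<Longrightarrow> link (w, 0) (w @ [a], 1 - int s)"
| rim: "w @ [a] \<in> words \<Longrightarrow> link (w @ [a], 0) (w @ [(a + 1) mod m], 0)"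

definition edges :: "(int list \<times> int) rel" where
  "edges = {(u, v). link u v \<or> link v u}"

definition preorder :: "int list \<times> int \<Rightarrow> int list \<times> int \<Rightarrow> bool" where
  "preorder u v \<longleftrightarrow> fst u < fst v \<or> fst u = fst v \<and> snd u < snd v"

lemma m_ge: "m \<ge> 4"
proof -
  have "3 * 1 \<le> (2 * int s + 1) * int t"
    using s t by (intro mult_mono) auto
  then show ?thesis by (simp add: m_def)
qed

lemma finite_words: "finite words"
  unfolding words_def by (rule finite_lists_length_le) simp

lemma finite_verts: "finite verts"
  by (simp add: verts_def finite_words)

lemma words_prefix: "w @ x \<in> words \<Longrightarrow> w \<in> words"
  by (auto simp: words_def)

lemma words_snoc_mod: "w @ [a] \<in> words \<Longrightarrow> w @ [b mod m] \<in> words"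
  using m_ge by (auto simp: words_def)

lemma edges_subset: "edges \<subseteq> verts \<times> verts"
proof -
  have "u \<in> verts \<and> v \<in> verts" if "link u v" for u v
    using that
  proof cases
    case (spoke w a)
    then show ?thesis using s by (auto simp: verts_def dest: words_prefix)
  next
    case (rim w a)
    then show ?thesis using s by (auto simp: verts_def words_snoc_mod)
  qed (auto simp: verts_def)
  then show ?thesis by (auto simp: edges_def)
qed

lemma sym_edges: "sym edges"
  by (auto simp: edges_def sym_def)

lemma irrefl_edges: "irrefl edges"
proof -
  have "\<not> link u u" for u
  proof
    assume "link u u"
    then show False
    proof cases
      case (rim w a)
      then have "a = (a + 1) mod m" "0 \<le> a" "a < m" by (auto simp: words_def)
      then show False using m_ge by (cases "a + 1 = m") auto
    qed auto
  qed
  then show ?thesis by (auto simp: edges_def irrefl_def)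
qed

lemma irreflp_preorder: "irreflp preorder"
  and transp_preorder: "transp preorder"
  and totalp_preorder: "totalp preorder"
  by (auto simp: irreflp_def transp_def totalp_on_def preorder_def)

text \<open>
  The rim edges form the lower page. The page of a chain edge is irrelevant: no edge crosses a
  chain edge, because the ends of a chain edge are neighbours in the preorder.
\<close>
lemma two_page:
  assumes uv: "(u, v) \<in> edges" and xy: "(x, y) \<in> edges"
    and less: "preorder u x" "preorder x v" "preorder v y"
  shows "(length (fst u) \<noteq> length (fst v)) \<noteq> (length (fst x) \<noteq> length (fst y))"
proof -
  \<comment> \<open>In the preorder, spokes lead downwards and rim edges join consecutive letters,
    except for the closing one, which joins \<open>0\<close> to \<open>m - 1\<close>.\<close>
  have oriented: "(\<exists>w j. u = (w, j) \<and> v = (w, j + 1)) \<or>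
      (\<exists>w a. u = (w, 0) \<and> v = (w @ [a], 1 - int s)) \<or>
      (\<exists>w a b. u = (w @ [a], 0) \<and> v = (w @ [b], 0) \<and> a < b \<and> b < m \<and>
        (b = a + 1 \<or> a = 0 \<and> b = m - 1))" (is "?chain \<or> ?spoke \<or> ?rim")
    if edge: "(u, v) \<in> edges" and pre: "preorder u v" for u v
  proof -
    have rim_step: "b = a + 1 \<and> b < m \<or> a = m - 1 \<and> b = 0"
      if "w @ [a] \<in> words" "b = (a + 1) mod m" for w a b
      using that m_ge by (cases "a + 1 = m") (auto simp: words_def)
    have pre': "\<not> preorder v u"
      using pre by (auto simp: preorder_def)
    from edge consider "link u v" | "link v u" by (auto simp: edges_def)
    then show ?thesis
    proof cases
      case 1
      then show ?thesis
      proof cases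
        case (rim w a)
        then have ?rim using rim_step[OF rim(3) refl] pre m_ge by (auto simp: preorder_def)
        then show ?thesis by blast
      qed blast+
    next
      case 2
      then show ?thesis
      proof cases
        case (chain w j)
        then show ?thesis using pre' by (simp add: preorder_def)
      next
        case (spoke w a)
        then have "preorder v u"
          using append_less_append_iff[of w "[]" "[a]"] by (simp add: preorder_def)
        then show ?thesis using pre' by blast
      next
        case (rim w a)
        then have ?rim using rim_step[OF rim(3) refl] pre m_ge by (auto simp: preorder_def)
        then show ?thesis by blast
      qed
    qed
  qed
  have no_middle: False if "preorder (w, j) z" "preorder z (w, j + 1)" for w j z
    using that by (auto simp: preorder_def)
  have "preorder u v" "preorder x y"
    using less transp_preorder by (auto dest: transpD)
  note oriented_uv = oriented[OF uv this(1)] and oriented_xy = oriented[OF xy this(2)]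
  from oriented_uv consider (chain) w j where "u = (w, j)" "v = (w, j + 1)"
    | (spoke) w a where "u = (w, 0)" "v = (w @ [a], 1 - int s)"
    | (rim) w a b where "u = (w @ [a], 0)" "v = (w @ [b], 0)" "b = a + 1 \<or> a = 0 \<and> b = m - 1"
    by blast
  note uv_cases = this
  from oriented_xy consider (chain) w j where "x = (w, j)" "y = (w, j + 1)"
    | (spoke) w a where "x = (w, 0)" "y = (w @ [a], 1 - int s)"
    | (rim) w a b where "x = (w @ [a], 0)" "y = (w @ [b], 0)" "b < m"
    by blast
  note xy_cases = this
  show ?thesis
  proof (cases rule: uv_cases)
    case chain
    then show ?thesis using no_middle less by blast
  next
    case u: (spoke w a)
    show ?thesis
    proof (cases rule: xy_cases)
      case chain
      then show ?thesis using no_middle less by blast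
    next
      case (spoke w' b)
      \<comment> \<open>Equality of \<open>w'\<close> and \<open>w @ [a]\<close> is excluded because
        the spoke edge ends at \<open>1 - int s \<le> 0\<close>, not beyond the node of its
        word.\<close>
      then have "w < w'" "w' < w @ [a]" "\<not> w' @ [b] < w @ [a]"
        using less s u by (auto simp: preorder_def)
      then show ?thesis using child_less_child by blast
    next
      case rim
      then show ?thesis using u by simp
    qed
  next
    case u: (rim w a b)
    show ?thesis
    proof (cases rule: xy_cases)
      case chain
      then show ?thesis using no_middle less by blast
    next
      case spoke
      then show ?thesis using u by simp
    next
      case (rim w' a' b')
      then have *: "w @ [a] < w' @ [a']" "w' @ [a'] < w @ [b]" "w @ [b] < w' @ [b']"
        using less u by (auto simp: preorder_def)
      then have "w = w'"
        using child_less_sibling by (metis less_asym)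
      then have "a < a'" "a' < b" "b < b'"
        using * by auto
      \<comment> \<open>\<open>b = a + 1\<close> leaves no room for \<open>a'\<close>, and
        \<open>b = m - 1\<close> leaves none for \<open>b'\<close>.\<close>
      then show ?thesis using u(3) rim(3) by auto
    qed
  qed
qed

section \<open>Walks along chains, spokes and rims\<close>

lemma chain_walk:
  assumes "w \<in> words" "1 - int s \<le> j" "j + int l \<le> int h"
  shows "((w, j), (w, j + int l)) \<in> edges ^^ l"
  using assms(3)
proof (induction l)
  case (Suc l)
  have "((w, j + int l), (w, j + int (Suc l))) \<in> edges"
    using link.chain[of w "j + int l"] assms(1,2) Suc.prems by (simp add: edges_def algebra_simps)
  with Suc show ?case by auto
qed simp

lemma ascent_walk:
  assumes "w @ x \<in> words"
  shows "((w @ x, 0), (w, 0)) \<in> edges ^^ (s * length x)"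
  using assms
proof (induction x rule: rev_induct)
  case (snoc a x)
  have "((w @ x, 0), ((w @ x) @ [a], 1 - int s)) \<in> edges"
    using snoc.prems link.spoke[of "w @ x" a] by (simp add: edges_def)
  moreover have "(((w @ x) @ [a], 1 - int s), ((w @ x) @ [a], 1 - int s + int (s - 1))) \<in> edges ^^ (s - 1)"
    using snoc.prems s by (intro chain_walk) auto
  ultimately have "((w @ x, 0), ((w @ x) @ [a], 0)) \<in> edges ^^ Suc (s - 1)"
    using s by (intro relpow_Suc_I2) auto
  then have "((w @ x @ [a], 0), (w @ x, 0)) \<in> edges ^^ s"
    using s sym_relpow[OF sym_edges] by simp
  moreover have "((w @ x, 0), (w, 0)) \<in> edges ^^ (s * length x)"
    using snoc words_prefix[of "w @ x" "[a]"] by simp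
  ultimately show ?case
    using relpow_trans by fastforce
qed simp

lemma rim_walk:
  assumes "w @ [a] \<in> words"
  shows "((w @ [a], 0), (w @ [(a + int l) mod m], 0)) \<in> edges ^^ l"
proof (induction l)
  case 0
  show ?case using assms by (simp add: words_def)
next
  case (Suc l)
  have "((w @ [(a + int l) mod m], 0), (w @ [((a + int l) mod m + 1) mod m], 0)) \<in> edges"
    using words_snoc_mod[OF assms] by (auto simp: edges_def intro: link.rim)
  with Suc show ?case by (auto simp: mod_simps algebra_simps)
qed

section \<open>Covering a cycle minus a vertex\<close>

text \<open>The centres are \<open>2 * int s + 1\<close> apart, starting \<open>int s + 1\<close>
  after \<open>a\<close>, so their balls of radius \<open>s\<close> are consecutive blocks that tile
  the other \<open>m - 1\<close> residues.\<close>

definition cover :: "int \<Rightarrow> int set" where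
  "cover a = (\<lambda>r. (a + int s + 1 + r * (2 * int s + 1)) mod m) ` {0..<int t}"

lemma cover_subset: "cover a \<subseteq> {0..<m}"
  using m_ge by (auto simp: cover_def)

text \<open>The extreme offsets are \<open>int s + 1\<close> and \<open>m - 1 - int s\<close>. Hence
  no offset wraps around, and every centre is farther than \<open>s\<close> from \<open>a\<close>
  both ways round.\<close>

lemma cover_offset:
  assumes "0 \<le> r" "r < int t"
  shows "int s < int s + 1 + r * (2 * int s + 1)" "int s + 1 + r * (2 * int s + 1) < m - int s"
proof -
  have "r * (2 * int s + 1) \<le> (int t - 1) * (2 * int s + 1)" "0 \<le> r * (2 * int s + 1)"
    using assms by (auto intro!: mult_right_mono)
  then show "int s < int s + 1 + r * (2 * int s + 1)" "int s + 1 + r * (2 * int s + 1) < m - int s"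
    by (auto simp: m_def algebra_simps)
qed

lemma card_cover: "card (cover a) = t"
proof -
  have "inj_on (\<lambda>r. (a + int s + 1 + r * (2 * int s + 1)) mod m) {0..<int t}"
  proof (rule inj_onI)
    fix r q assume *: "r \<in> {0..<int t}" "q \<in> {0..<int t}"
      "(a + int s + 1 + r * (2 * int s + 1)) mod m = (a + int s + 1 + q * (2 * int s + 1)) mod m"
    then have "(int s + 1 + r * (2 * int s + 1)) mod m = (int s + 1 + q * (2 * int s + 1)) mod m"
      by (metis (no_types, opaque_lifting) add.assoc mod_add_left_eq add_diff_cancel_left' mod_diff_left_eq mod_diff_right_eq)
    then have "int s + 1 + r * (2 * int s + 1) = int s + 1 + q * (2 * int s + 1)"
      using cover_offset[of r] cover_offset[of q] *(1,2) by simp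
    then show "r = q" by simp
  qed
  then show ?thesis by (simp add: cover_def card_image)
qed

lemma cover_near:
  assumes "x \<in> {0..<m}" "y \<in> {0..<m}" "x \<noteq> y"
  obtains c l where "c \<in> cover y" "l \<le> s" "x = (c + int l) mod m \<or> c = (x + int l) mod m"
proof -
  define p where "p = 2 * int s + 1"
  \<comment> \<open>The offset counts from the residue just after \<open>y\<close>. It splits into a
    block \<open>r\<close> and a position \<open>q\<close> in that block, whose centre is at
    position \<open>s\<close>.\<close>
  define d where "d = (x - y) mod m - 1"
  define r where "r = d div p"
  define q where "q = d mod p"
  have "(x - y) mod m \<noteq> 0"
    using assms by (metis atLeastLessThan_iff mod_pos_pos_trivial right_minus_eq mod_eq_dvd_iff dvd_eq_mod_eq_0)
  moreover have "0 \<le> (x - y) mod m" "(x - y) mod m < p * int t + 1"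
    using m_ge unfolding p_def m_def[symmetric] by simp_all
  ultimately have d: "0 \<le> d" "d < p * int t"
    unfolding d_def by auto
  have p: "p > 0" by (simp add: p_def)
  have "0 \<le> r" using d(1) p by (simp add: r_def pos_imp_zdiv_nonneg_iff)
  moreover have "p * r + d mod p = d" "0 \<le> d mod p" using p by (simp_all add: r_def)
  then have "p * r < p * int t" using d(2) by linarith
  ultimately have r: "0 \<le> r" "r < int t"
    using p by auto
  define c where "c = (y + int s + 1 + r * p) mod m"
  have c: "c \<in> cover y"
    using r by (auto simp: c_def cover_def p_def)
  have q: "0 \<le> q" "q < p" using p by (simp_all add: q_def)
  have eq: "x = (y + r * p + q + 1) mod m"
  proof -
    have "(y + r * p + q + 1) mod m = (y + (x - y) mod m) mod m"
      by (simp add: r_def q_def add.assoc) (simp add: d_def)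
    then show ?thesis using assms by (simp add: mod_simps)
  qed
  show ?thesis
  proof (cases "q \<ge> int s")
    case True
    have "x = (c + int (nat (q - int s))) mod m"
    proof -
      have "x = (y + int s + 1 + r * p + (q - int s)) mod m"
        by (simp add: eq algebra_simps)
      then show ?thesis using True by (simp add: c_def mod_add_left_eq)
    qed
    with True c q show ?thesis by (intro that[of c "nat (q - int s)"]) (auto simp: p_def)
  next
    case False
    have "c = (x + int (nat (int s - q))) mod m"
    proof -
      have "c = (y + r * p + q + 1 + (int s - q)) mod m"
        by (simp add: c_def algebra_simps)
      then show ?thesis using False by (simp add: eq mod_add_left_eq)
    qed
    with False c q show ?thesis by (intro that[of c "nat (int s - q)"]) auto
  qed
qed

section \<open>Potentials as lower bounds on distances\<close>

text \<open>Capped, because the path through the hub may be shorter than the path along the rim.\<close>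
definition rim_dist :: "int \<Rightarrow> int \<Rightarrow> int" where
  "rim_dist c y = min (int s + 1) (min ((c - y) mod m) (m - (c - y) mod m))"

lemma rim_dist_bounds: "0 \<le> rim_dist c y" "rim_dist c y \<le> int s + 1"
proof -
  have "0 \<le> (c - y) mod m" "(c - y) mod m < m" using m_ge by simp_all
  then show "0 \<le> rim_dist c y" "rim_dist c y \<le> int s + 1"
    by (auto simp: rim_dist_def)
qed

lemma rim_dist_self: "rim_dist c c = 0"
  using m_ge by (simp add: rim_dist_def)

lemma rim_dist_lipschitz: "\<bar>rim_dist c y - rim_dist c ((y + 1) mod m)\<bar> \<le> 1"
proof -
  define z where "z = (c - y) mod m"
  have z: "0 \<le> z" "z < m" using m_ge by (auto simp: z_def)
  have "(c - (y + 1) mod m) mod m = (z - 1) mod m"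
    by (simp add: z_def mod_simps algebra_simps)
  also have "\<dots> = (if z = 0 then m - 1 else z - 1)"
    using z m_ge by (auto simp: zmod_minus1)
  finally show ?thesis
    using z m_ge unfolding rim_dist_def by (auto simp flip: z_def)
qed

lemma rim_dist_cover:
  assumes "c \<in> cover a"
  shows "rim_dist c a = int s + 1"
proof -
  obtain r where r: "0 \<le> r" "r < int t" "c = (a + int s + 1 + r * (2 * int s + 1)) mod m"
    using assms by (auto simp: cover_def)
  then have "(c - a) mod m = (int s + 1 + r * (2 * int s + 1)) mod m"
    by (simp add: mod_simps algebra_simps)
  then have "(c - a) mod m = int s + 1 + r * (2 * int s + 1)"
    using cover_offset[OF r(1,2)] by simp
  then show ?thesis
    using cover_offset[OF r(1,2)] by (simp add: rim_dist_def)
qed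

text \<open>
  Up to an additive constant, a lower bound for the distance to the pendant path at \<open>w @ [c]\<close>,
  negative on that path. Vertices outside the subtree of \<open>w\<close> only reach the rim below \<open>w\<close> through
  \<open>w\<close>, at distance \<open>s\<close>.
\<close>
definition potential :: "int list \<Rightarrow> int \<Rightarrow> int list \<times> int \<Rightarrow> int" where
  "potential w c v = (case v of (x, j) \<Rightarrow>
    (case drop (length w) x of
      [] \<Rightarrow> int s
    | b # y \<Rightarrow>
        if take (length w) x \<noteq> w then int s
        else if y \<noteq> [] then rim_dist c b + int (s * length y) + min j 0
        else if j < 0 then min (rim_dist c b - j) (int s)
        else if b = c then - j
        else rim_dist c b))"

lemma potential_inside:
  "potential w c (w @ b # y, j) =
    (if y \<noteq> [] then rim_dist c b + int (s * length y) + min j 0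
     else if j < 0 then min (rim_dist c b - j) (int s)
     else if b = c then - j
     else rim_dist c b)"
  by (simp add: potential_def)

lemma potential_outside:
  assumes "\<And>b y. x \<noteq> w @ b # y"
  shows "potential w c (x, j) = int s"
proof -
  have "take (length w) x \<noteq> w" if "drop (length w) x = b # y" for b y
    using assms[of b y] that append_take_drop_id[of "length w" x] by metis
  then show ?thesis
    by (auto simp: potential_def split: list.splits)
qed

lemma potential_chain:
  assumes "1 - int s \<le> j"
  shows "\<bar>potential w c (x, j) - potential w c (x, j + 1)\<bar> \<le> 1"
proof (cases "\<exists>b y. x = w @ b # y")
  case True
  then obtain b y where "x = w @ b # y" by blast
  then show ?thesis
    using rim_dist_bounds[of c b] s rim_dist_self[of c]
    by (auto simp: potential_inside min_def)
next
  case False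
  then show ?thesis by (simp add: potential_outside)
qed

text \<open>The hub \<open>w\<close> has value \<open>int s\<close>. If a spoke below it has inner
  vertices, the cap gives the first one the value \<open>int s - 1\<close> or \<open>int s\<close>;
  if \<open>s = 1\<close>, the edge ends on the rim, where the values are between \<open>0\<close>
  and \<open>2\<close>.\<close>

lemma potential_spoke: "\<bar>potential w c (x, 0) - potential w c (x @ [a], 1 - int s)\<bar> \<le> 1"
proof -
  consider (inside) b y where "x = w @ b # y" | (hub) "x = w" | (outside) "\<And>b y. x \<noteq> w @ b # y" "x \<noteq> w"
    by blast
  then show ?thesis
  proof cases
    case inside
    then show ?thesis
      using rim_dist_self[of c] s by (auto simp: potential_inside algebra_simps)
  next
    case hub
    have "potential w c (w, 0) = int s" by (intro potential_outside) auto
    then show ?thesis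
      using hub s rim_dist_bounds[of c a] rim_dist_self[of c] by (auto simp: potential_inside min_def)
  next
    case outside
    have "x @ [a] \<noteq> w @ b # y" for b y
      using outside by (cases y rule: rev_cases) auto
    with outside show ?thesis by (simp add: potential_outside)
  qed
qed

lemma potential_rim:
  "\<bar>potential w c (x @ [a], 0) - potential w c (x @ [(a + 1) mod m], 0)\<bar> \<le> 1"
proof -
  consider (inside) b y where "x = w @ b # y" | (hub) "x = w" | (outside) "\<And>b y. x \<noteq> w @ b # y" "x \<noteq> w"
    by blast
  then show ?thesis
  proof cases
    case inside
    then show ?thesis by (simp add: potential_inside)
  next
    case hub
    then show ?thesis
      using rim_dist_lipschitz[of c a] rim_dist_self[of c] by (auto simp: potential_inside)
  next
    case outside
    have "x @ [a] \<noteq> w @ b # y" for a b y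
      using outside by (cases y rule: rev_cases) auto
    with outside show ?thesis by (simp add: potential_outside)
  qed
qed

lemma potential_lipschitz:
  assumes "(u, v) \<in> edges"
  shows "potential w c u - potential w c v \<le> 1"
proof -
  have "\<bar>potential w c u - potential w c v\<bar> \<le> 1" if "link u v" for u v
    using that by cases (auto intro: potential_chain potential_spoke potential_rim)
  from this[of u v] this[of v u] show ?thesis
    using assms by (auto simp: edges_def)
qed


text \<open>On the cover the capped rim distance attains \<open>int s + 1\<close>; every further
  level adds \<open>int s\<close>, and the pendant path contributes \<open>j\<close>.\<close>

lemma potential_leaf:
  assumes "c \<in> cover a" "0 \<le> j"
  shows "potential w c (w @ a # x, 0) - potential w c (w @ [c], j) = int s + 1 + int (s * length x) + j"
proof -
  have "a \<noteq> c" using rim_dist_cover[OF assms(1)] rim_dist_self[of c] by auto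
  then show ?thesis
    using assms rim_dist_cover[OF assms(1)] by (auto simp: potential_inside)
qed

section \<open>Leaves and their target sets\<close>

definition leaves :: "int list set" where
  "leaves = {a. set a \<subseteq> {0..<m} \<and> length a = n}"

lemma card_leaves: "card leaves = ((2 * s + 1) * t + 1) ^ n"
proof -
  have "nat m = (2 * s + 1) * t + 1"
    by (simp add: m_def nat_add_distrib nat_mult_distrib)
  then show ?thesis
    by (simp add: leaves_def card_lists_length_eq)
qed

text \<open>Ascending from a leaf to the rim at level \<open>i\<close> takes
  \<open>s * (n - Suc i)\<close> steps. The displacement brings this, with \<open>s\<close> rim
  steps, to exactly \<open>d\<close>; the leaf \<open>a\<close> itself is charged
  \<open>s + 1\<close> at the rim, hence \<open>d + 1\<close>.\<close>

definition targets :: "nat \<Rightarrow> int list \<Rightarrow> (int list \<times> int) set" where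
  "targets d a = (\<lambda>(i, c). (take i a @ [c], int d - int (s * (n - i)))) ` (SIGMA i:{..<n}. cover (a ! i))"

text \<open>These are the candidates for padding: moving outwards from a target, the lower bound on
  the distance from \<open>a\<close> only grows.\<close>

definition far :: "nat \<Rightarrow> int list \<Rightarrow> (int list \<times> int) set" where
  "far d a = {(take i a @ [c], j) |i c j. i < n \<and> c \<in> cover (a ! i) \<and>
    int d - int (s * (n - i)) \<le> j \<and> j \<le> int h}"

text \<open>Targets of different levels differ because their words have different lengths.\<close>

lemma card_targets:
  assumes "a \<in> leaves"
  shows "card (targets d a) = n * t"
proof -
  have "inj_on (\<lambda>(i, c). (take i a @ [c], int d - int (s * (n - i)))) (SIGMA i:{..<n}. cover (a ! i))"
  proof (rule inj_onI)
    fix p q assume pq: "p \<in> (SIGMA i:{..<n}. cover (a ! i))" "q \<in> (SIGMA i:{..<n}. cover (a ! i))"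
      and eq: "(\<lambda>(i, c). (take i a @ [c], int d - int (s * (n - i)))) p =
        (\<lambda>(i, c). (take i a @ [c], int d - int (s * (n - i)))) q"
    have "length (take (fst p) a) = length (take (fst q) a)" "snd p = snd q"
      using eq by (auto simp: case_prod_unfold simp del: length_take)
    moreover have "fst p < length a" "fst q < length a"
      using pq assms by (auto simp: leaves_def)
    ultimately show "p = q" by (auto simp: prod_eq_iff)
  qed
  moreover have "finite (cover x)" for x by (simp add: cover_def)
  ultimately show ?thesis
    by (simp add: targets_def card_image card_SigmaI card_cover)
qed

lemma leaf_in_verts:
  assumes "a \<in> leaves"
  shows "(a, 0) \<in> verts"
  using assms s by (simp add: leaves_def verts_def words_def)

lemma branch_in_words:
  assumes "a \<in> leaves" "i < n" "c \<in> {0..<m}"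
  shows "take i a @ [c] \<in> words"
  using assms set_take_subset[of i a] by (auto simp: leaves_def words_def)

context
  fixes d :: nat
  assumes d: "s * n \<le> d" "d \<le> h"
begin

lemma budget:
  assumes "i < n"
  shows "int s * int (n - Suc i) + int s + (int d - int (s * (n - i))) = int d" "s * (n - i) \<le> d"
proof -
  obtain e where "n - Suc i = e" "n - i = Suc e" using assms by (metis Suc_diff_Suc)
  then show "int s * int (n - Suc i) + int s + (int d - int (s * (n - i))) = int d"
    by (simp add: algebra_simps)
  have "s * (n - i) \<le> s * n" by simp
  then show "s * (n - i) \<le> d" using d by linarith
qed

lemma far_in_verts:
  assumes "a \<in> leaves"
  shows "far d a \<subseteq> verts"
proof
  fix v assume "v \<in> far d a"
  then obtain i c j where v: "v = (take i a @ [c], j)" "i < n" "c \<in> cover (a ! i)"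
    "int d - int (s * (n - i)) \<le> j" "j \<le> int h"
    by (auto simp: far_def)
  moreover have "0 \<le> j" using v(4) budget(2)[OF v(2)] by linarith
  ultimately show "v \<in> verts"
    using branch_in_words[OF assms, of i c] cover_subset[of "a ! i"] s by (auto simp: verts_def)
qed

lemma targets_subset_far: "targets d a \<subseteq> far d a"
proof
  fix v assume "v \<in> targets d a"
  then obtain i c where v: "i < n" "c \<in> cover (a ! i)" "v = (take i a @ [c], int d - int (s * (n - i)))"
    by (auto simp: targets_def)
  moreover have "int d - int (s * (n - i)) \<le> int h"
    using d by linarith
  ultimately show "v \<in> far d a"
    unfolding far_def by blast
qed

text \<open>The pendant path of a single cover vertex at level \<open>0\<close> suffices: all its
  positions beyond \<open>d\<close> qualify.\<close>

lemma card_far_ge: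
  assumes "a \<in> leaves" "1 \<le> n"
  shows "h - d \<le> card (far d a)"
proof -
  obtain c where c: "c \<in> cover (a ! 0)"
    using card_cover[of "a ! 0"] t by fastforce
  have "inj_on (\<lambda>j. ([c], j)) {int d<..int h}" by (auto simp: inj_on_def)
  then have "card ((\<lambda>j. ([c], j)) ` {int d<..int h}) = h - d"
    by (simp add: card_image)
  moreover have "(\<lambda>j. ([c], j)) ` {int d<..int h} \<subseteq> far d a"
  proof clarify
    fix j assume j: "j \<in> {int d<..int h}"
    then have "int d < j" by simp
    then have "int d - int (s * (n - 0)) \<le> j" by linarith
    then have "(take 0 a @ [c], j) \<in> far d a"
      using j c assms(2) unfolding far_def by auto
    then show "([c], j) \<in> far d a" by simp
  qed
  moreover have "finite (far d a)"
    using far_in_verts[OF assms(1)] finite_verts finite_subset by blast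
  ultimately show ?thesis by (metis card_mono)
qed

lemma potential_far:
  assumes "a \<in> leaves" "v \<in> far d a"
  obtains w c where "potential w c (a, 0) - potential w c v > int d"
proof -
  obtain i c j where v: "v = (take i a @ [c], j)" "i < n" "c \<in> cover (a ! i)"
    "int d - int (s * (n - i)) \<le> j"
    using assms by (auto simp: far_def)
  have "0 \<le> j" using v(4) budget(2)[OF v(2)] by linarith
  moreover have "a = take i a @ a ! i # drop (Suc i) a" "length a = n"
    using v(2) assms(1) by (auto simp: leaves_def id_take_nth_drop)
  ultimately have "potential (take i a) c (a, 0) - potential (take i a) c v
      = int s + 1 + int (s * (n - Suc i)) + j"
    using potential_leaf[OF v(3), of j "take i a" "drop (Suc i) a"] v(1) by simp
  with budget(1)[OF v(2)] v(4) have "potential (take i a) c (a, 0) - potential (take i a) c v > int d"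
    by simp
  then show ?thesis by (rule that)
qed

text \<open>Climb from \<open>a\<close> to the rim below the longest common prefix \<open>w\<close>,
  take at most \<open>s\<close> rim steps to a cover vertex of \<open>y\<close>, and follow its
  pendant path. By \<open>budget\<close> the total is at most \<open>d\<close>.\<close>

lemma targets_near:
  assumes a: "a \<in> leaves" and b: "b \<in> leaves" and "a \<noteq> b"
  obtains v l where "v \<in> targets d b" "l \<le> d" "((a, 0), v) \<in> edges ^^ l"
proof -
  have "length a = length b"
    using a b by (simp add: leaves_def)
  from same_length_different[OF \<open>a \<noteq> b\<close> this]
  obtain w x xs y ys where ab: "x \<noteq> y" "a = w @ [x] @ xs" "b = w @ [y] @ ys"
    by blast
  define i where "i = length w"
  have i: "i < n" "length xs = n - Suc i" "take i b = w" "b ! i = y"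
    using a ab by (auto simp: leaves_def i_def)
  have xy: "x \<in> {0..<m}" "y \<in> {0..<m}"
    using a b ab by (auto simp: leaves_def)
  obtain c l where c: "c \<in> cover y" "l \<le> s" "x = (c + int l) mod m \<or> c = (x + int l) mod m"
    using cover_near[OF xy ab(1)] by blast
  have words: "w @ [c] \<in> words" "w @ [x] \<in> words" "(w @ [x]) @ xs \<in> words"
    using branch_in_words[OF b i(1), of c] i cover_subset[of y] c(1) xy a ab
    by (auto simp: leaves_def words_def)
  have "((a, 0), (w @ [x], 0)) \<in> edges ^^ (s * (n - Suc i))"
    using ascent_walk[OF words(3)] ab i by simp
  moreover have "((w @ [x], 0), (w @ [c], 0)) \<in> edges ^^ l"
    using c(3) rim_walk[OF words(1), of l] rim_walk[OF words(2), of l] sym_relpow[OF sym_edges]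
    by auto
  moreover have "((w @ [c], 0), (w @ [c], 0 + int (d - s * (n - i)))) \<in> edges ^^ (d - s * (n - i))"
    using words d s by (intro chain_walk) auto
  ultimately have walk: "((a, 0), (w @ [c], int (d - s * (n - i))))
      \<in> edges ^^ (s * (n - Suc i) + l + (d - s * (n - i)))"
    by (auto intro: relpow_trans)
  have "(w @ [c], int (d - s * (n - i))) \<in> targets d b"
    unfolding targets_def using i c(1) budget(2)[OF i(1)]
    by (intro image_eqI[of _ _ "(i, c)"]) (auto simp: of_nat_diff)
  moreover have "s * (n - Suc i) + l + (d - s * (n - i)) \<le> d"
    using budget[OF i(1)] c(2) by (simp add: of_nat_diff flip: of_nat_mult)
  ultimately show ?thesis
    using walk that by blast
qed

end

text \<open>
  The second component of a pair consists of its targets, padded by vertices further along their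
  pendant paths in order to have exactly \<open>k\<close> elements.
\<close>
theorem planar_comatching:
  assumes "1 \<le> n" "s * n \<le> d" "t * n \<le> k" "h = d + k"
  shows "\<exists>(G :: nat pair_pre_digraph) M.
    planar_graph G \<and> comatching G k d M \<and> card M = ((2 * s + 1) * t + 1) ^ n"
proof -
  have d: "s * n \<le> d" "d \<le> h" using assms by auto
  obtain r :: "int list \<times> int \<Rightarrow> nat" where r: "inj_on r verts"
    and planar: "planar_graph (image_graph r verts edges)"
    using two_page_image_graph[where upper = "\<lambda>u v. length (fst u) \<noteq> length (fst v)",
        OF finite_verts edges_subset sym_edges irrefl_edges
        irreflp_preorder transp_preorder totalp_on_subset[OF totalp_preorder subset_UNIV] two_page]
    by blast
  define G where "G = image_graph r verts edges"
  have G: "pair_graph G"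
    using planar by (simp add: G_def planar_graph_def)
  \<comment> \<open>There are \<open>n * t \<le> k\<close> targets and at least
    \<open>h - d = k\<close> candidates, so a set of exactly \<open>k\<close> vertices fits in
    between.\<close>
  have "\<exists>X. targets d a \<subseteq> X \<and> X \<subseteq> far d a \<and> card X = k" if "a \<in> leaves" for a
    using exists_subset_between[OF _ _ targets_subset_far[OF d]] card_targets[OF that] assms
      card_far_ge[OF d that] finite_subset[OF far_in_verts[OF d that] finite_verts]
    by (simp add: mult.commute)
  then obtain X where X: "\<And>a. a \<in> leaves \<Longrightarrow> targets d a \<subseteq> X a"
    "\<And>a. a \<in> leaves \<Longrightarrow> X a \<subseteq> far d a" "\<And>a. a \<in> leaves \<Longrightarrow> card (X a) = k"
    by metis
  have X_verts: "X a \<subseteq> verts" if "a \<in> leaves" for a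
    using X(2)[OF that] far_in_verts[OF d that] by blast
  have X_finite: "finite (X a)" if "a \<in> leaves" for a
    using X_verts[OF that] finite_verts finite_subset by blast
  \<comment> \<open>Being finite and nonempty, \<open>X a\<close> makes \<open>Min\<close> in
    \<open>hop_dist_set\<close> a genuine minimum.\<close>
  have X_ne: "X a \<noteq> {}" if "a \<in> leaves" for a
    using X(3)[OF that] assms t by auto
  define M where "M = (\<lambda>a. (r (a, 0), r ` X a)) ` leaves"
  have far: "hop_dist_set G (r (a, 0)) (r ` X a) > ereal (real d)" if a: "a \<in> leaves" for a
  proof -
    have "hop_dist G (r (a, 0)) (r v) > ereal (real d)" if v: "v \<in> X a" for v
    proof -
      obtain w c where "potential w c (a, 0) - potential w c v > int d"
        using potential_far[OF d a] X(2)[OF a] v by blast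
      then have "ereal (real d) < ereal (real_of_int (potential w c (a, 0) - potential w c v))"
        by simp
      also have "\<dots> \<le> hop_dist G (r (a, 0)) (r v)"
        using G r edges_subset leaf_in_verts[OF a] X_verts[OF a] v potential_lipschitz
        unfolding G_def by (intro hop_dist_image_graph_ge) auto
      finally show ?thesis .
    qed
    then show ?thesis
      unfolding hop_dist_set_def using X_finite[OF a] X_ne[OF a] by simp
  qed
  have near: "hop_dist_set G (r (a, 0)) (r ` X b) \<le> ereal (real d)"
    if ab: "a \<in> leaves" "b \<in> leaves" "a \<noteq> b" for a b
  proof -
    obtain v l where v: "v \<in> targets d b" "l \<le> d" "((a, 0), v) \<in> edges ^^ l"
      using targets_near[OF d ab] .
    have "hop_dist_set G (r (a, 0)) (r ` X b) \<le> hop_dist G (r (a, 0)) (r v)"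
      unfolding hop_dist_set_def using X_finite[OF ab(2)] v(1) X(1)[OF ab(2)] by auto
    also have "\<dots> \<le> ereal (real l)"
      using hop_dist_image_graph_le[OF G[unfolded G_def] v(3) leaf_in_verts[OF ab(1)]]
      by (simp add: G_def)
    also have "\<dots> \<le> ereal (real d)" using v(2) by simp
    finally show ?thesis .
  qed
  have "card (r ` X a) = k" if "a \<in> leaves" for a
    using X(3)[OF that] card_image[OF inj_on_subset[OF r X_verts[OF that]]] by simp
  then have "comatching G k d M"
    unfolding comatching_def using far near leaf_in_verts X_verts
    by (fastforce simp: M_def G_def image_graph_def)
  moreover have "card M = card leaves"
    unfolding M_def
  proof (rule card_image, rule inj_onI)
    fix a b assume "a \<in> leaves" "b \<in> leaves" "(r (a, 0), r ` X a) = (r (b, 0), r ` X b)"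
    then show "a = b" using inj_onD[OF r, of "(a, 0)" "(b, 0)"] leaf_in_verts by auto
  qed
  ultimately show ?thesis
    using planar card_leaves by (auto simp: G_def)
qed

end

theorem theorem1p13:
  fixes k d :: nat
  assumes "k \<ge> 1" and "d \<ge> 1"
  shows "\<exists>(G :: nat pair_pre_digraph) M.
           planar_graph G \<and> comatching G k d M \<and>
           (k \<le> d \<longrightarrow> card M \<ge> (2 * (d div k) + 2) ^ k) \<and>
           (d \<le> k \<longrightarrow> card M \<ge> (3 * (k div d) + 1) ^ d)"
proof -
  define n where "n = min k d"
  define s where "s = d div n"
  define t where "t = k div n"
  have n: "1 \<le> n" "n \<le> k" "n \<le> d"
    using assms by (auto simp: n_def)
  \<comment> \<open>Targets sit at positions at most \<open>d\<close>; the \<open>k\<close>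
    positions beyond leave room for padding.\<close>
  interpret wheel_tree s t n "d + k"
    using n by unfold_locales (auto simp: s_def t_def div_greater_zero_iff Suc_le_eq)
  have "s * n \<le> d" "t * n \<le> k"
    by (auto simp: s_def t_def)
  then obtain G :: "nat pair_pre_digraph" and M where GM: "planar_graph G" "comatching G k d M"
    "card M = ((2 * s + 1) * t + 1) ^ n"
    using planar_comatching n by blast
  \<comment> \<open>Here \<open>n = k\<close> and \<open>t = 1\<close>, so the rim length is
    \<open>2 * s + 2\<close>.\<close>
  have "card M = (2 * (d div k) + 2) ^ k" if "k \<le> d"
    using that assms by (simp add: GM n_def s_def t_def min_def)
  \<comment> \<open>Here \<open>n = d\<close> and \<open>s = 1\<close>, so the rim length is
    \<open>3 * t + 1\<close>.\<close>
  moreover have "card M = (3 * (k div d) + 1) ^ d" if "d \<le> k"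
  proof -
    have "n = d" using that by (simp add: n_def)
    then show ?thesis using assms by (simp add: GM s_def t_def)
  qed
  ultimately show ?thesis
    using GM by force
qed

end
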